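(* There exist Banach spaces $X,Y$ and two nuclear operators $t_1: X\to Y$ and $t_2: Y\to X$ such that the sequence of all eigenvalues of the product $t_2t_1$ belongs to $l_1\setminus\bigcup_{s<1}l_{1,s}$.
   Context: An operator $T\in L(X,Y)$ between (complex) Banach spaces is nuclear if $Tx=\sum_{n=1}^\infty\mu_n\langle x_n',x\rangle y_n$ for $x\in X$, with $(x_n')\subset X^*$, $(y_n)\subset Y$ bounded and $\sum|\mu_n|<\infty$. The eigenvalue sequence of a compact operator is the complete sequence of its nonzero eigenvalues counted with algebraic multiplicities. For $0<p,q<\infty$ the Lorentz sequence space $l_{p,q}$ consists of all sequences $x$ tending to zero with $\sum_{n=1}^\infty n^{q/p-1}(x_n^* )^q<\infty$, where $(x_n^* )$ is the non-increasing rearrangement of $(|x_n|)$. The union is over $0<s<1$. *)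

theory Defs
  imports Complex_Main "HOL-Library.Function_Algebras"
begin

text \<open>
  Banach spaces are given by a carrier, which is a linear subspace of an ambient complex vector
  space, together with a norm on the carrier. The ambient space carries no topology, and nothing
  is required of the norm outside the carrier. Spaces are thus terms, not types, and can be
  quantified existentially.
\<close>

locale complex_vector_space = vector_space scale
  for scale :: "complex \<Rightarrow> 'v::ab_group_add \<Rightarrow> 'v"  (infixr \<open>*\<^sub>C\<close> 75)
begin

definition banach_space_on :: "'v set \<Rightarrow> ('v \<Rightarrow> real) \<Rightarrow> bool" where
  "banach_space_on X nX \<longleftrightarrow>
     subspace X \<and>
     (\<forall>x\<in>X. 0 \<le> nX x) \<and>
     (\<forall>x\<in>X. nX x = 0 \<longleftrightarrow> x = 0) \<and>
     (\<forall>c. \<forall>x\<in>X. nX (c *\<^sub>C x) = cmod c * nX x) \<and>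
     (\<forall>x\<in>X. \<forall>y\<in>X. nX (x + y) \<le> nX x + nX y) \<and>
     (\<forall>u. (\<forall>n. u n \<in> X) \<and> (\<forall>\<epsilon>>0. \<exists>N. \<forall>m\<ge>N. \<forall>n\<ge>N. nX (u m - u n) < \<epsilon>)
        \<longrightarrow> (\<exists>x\<in>X. (\<lambda>n. nX (u n - x)) \<longlonglongrightarrow> 0))"

definition bounded_operator ::
    "'v set \<Rightarrow> ('v \<Rightarrow> real) \<Rightarrow> 'v set \<Rightarrow> ('v \<Rightarrow> real) \<Rightarrow> ('v \<Rightarrow> 'v) \<Rightarrow> bool" where
  "bounded_operator X nX Y nY T \<longleftrightarrow>
     (\<forall>x\<in>X. T x \<in> Y) \<and>
     (\<forall>x\<in>X. \<forall>y\<in>X. T (x + y) = T x + T y) \<and>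
     (\<forall>c. \<forall>x\<in>X. T (c *\<^sub>C x) = c *\<^sub>C T x) \<and>
     (\<exists>C. \<forall>x\<in>X. nY (T x) \<le> C * nX x)"

definition linear_functional_on :: "'v set \<Rightarrow> ('v \<Rightarrow> complex) \<Rightarrow> bool" where
  "linear_functional_on X \<phi> \<longleftrightarrow>
     (\<forall>x\<in>X. \<forall>y\<in>X. \<phi> (x + y) = \<phi> x + \<phi> y) \<and>
     (\<forall>c. \<forall>x\<in>X. \<phi> (c *\<^sub>C x) = c * \<phi> x)"

text \<open>
  The uniform constant \<open>C\<close> below says that the functionals \<open>x' n\<close> are continuous and that
  the sequence \<open>x'\<close> is bounded in the dual norm.
\<close>

definition nuclear_operator ::
    "'v set \<Rightarrow> ('v \<Rightarrow> real) \<Rightarrow> 'v set \<Rightarrow> ('v \<Rightarrow> real) \<Rightarrow> ('v \<Rightarrow> 'v) \<Rightarrow> bool" where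
  "nuclear_operator X nX Y nY T \<longleftrightarrow>
     bounded_operator X nX Y nY T \<and>
     (\<exists>(\<mu> :: nat \<Rightarrow> complex) x' y.
        summable (\<lambda>n. cmod (\<mu> n)) \<and>
        (\<forall>n. linear_functional_on X (x' n)) \<and>
        (\<exists>C. \<forall>n. \<forall>x\<in>X. cmod (x' n x) \<le> C * nX x) \<and>
        (\<forall>n. y n \<in> Y) \<and>
        (\<exists>C. \<forall>n. nY (y n) \<le> C) \<and>
        (\<forall>x\<in>X. (\<lambda>N. nY (T x - (\<Sum>n<N. (\<mu> n * x' n x) *\<^sub>C y n))) \<longlonglongrightarrow> 0))"

definition generalized_eigenspace :: "'v set \<Rightarrow> ('v \<Rightarrow> 'v) \<Rightarrow> complex \<Rightarrow> 'v set" where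
  "generalized_eigenspace X T z = {x \<in> X. \<exists>k. ((\<lambda>v. T v - z *\<^sub>C v) ^^ k) x = 0}"

text \<open>
  The sequence \<open>e\<close> lists every nonzero eigenvalue of \<open>T\<close> as often as its algebraic
  multiplicity indicates, in any order; if there are only finitely many, the list is continued
  by zeros. The clause on \<open>B\<close> (automatic for compact \<open>T\<close>) is needed because
  \<^const>\<open>dim\<close> is 0 on infinite-dimensional spaces.
\<close>

definition eigenvalue_sequence :: "'v set \<Rightarrow> ('v \<Rightarrow> 'v) \<Rightarrow> (nat \<Rightarrow> complex) \<Rightarrow> bool" where
  "eigenvalue_sequence X T e \<longleftrightarrow>
     (\<forall>z. z \<noteq> 0 \<longrightarrow>
        (\<exists>B. finite B \<and> generalized_eigenspace X T z \<subseteq> span B) \<and>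
        finite {n. e n = z} \<and>
        card {n. e n = z} = dim (generalized_eigenspace X T z)) \<and>
     (\<forall>m n. m \<le> n \<and> e m = 0 \<longrightarrow> e n = 0)"

end

text \<open>
  Ambient space of all complex sequences with pointwise operations. Its dimension is that of the
  continuum, so up to isometric isomorphism its subspaces with complete norms include all
  separable Banach spaces.
\<close>

interpretation cseq: complex_vector_space "\<lambda>c (f :: nat \<Rightarrow> complex) i. c * f i"
  by unfold_locales (auto simp: fun_eq_iff algebra_simps)

text \<open>Indices start at 0: \<open>decreasing_rearrangement x n\<close> is the usual \<open>x\<^sup>*\<close> at \<open>n + 1\<close>.\<close>

definition decreasing_rearrangement :: "(nat \<Rightarrow> complex) \<Rightarrow> nat \<Rightarrow> real" where
  "decreasing_rearrangement x n =
     Inf {t. 0 \<le> t \<and> finite {k. t < cmod (x k)} \<and> card {k. t < cmod (x k)} \<le> n}"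

definition lorentz_space :: "real \<Rightarrow> real \<Rightarrow> (nat \<Rightarrow> complex) set" where
  "lorentz_space p q =
     {x. x \<longlonglongrightarrow> 0 \<and>
         summable (\<lambda>n. real (n + 1) powr (q / p - 1) * decreasing_rearrangement x n powr q)}"

definition l1_space :: "(nat \<Rightarrow> complex) set" where
  "l1_space = {x. summable (\<lambda>n. cmod (x n))}"

end

theory Submission
  imports Defs "HOL-Real_Asymp.Real_Asymp"
begin

text \<open>
  On \<open>X = l_1\<close>, \<open>Y = l_\<infinity>\<close> every diagonal operator with entries \<open>e \<in> l_1\<close> is a product of two nuclear
  diagonal operators. Write \<open>e = b d\<close> with \<open>b \<in> l_1\<close> and \<open>d \<rightarrow> 0\<close>, taking for \<open>d\<close> the square roots of the
  tails of \<open>\<Sum> e\<close>. The operator \<open>diag b: l_\<infinity> \<rightarrow> l_1\<close> is trivially nuclear. The identity of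
  \<open>l_1^L \<rightarrow> l_\<infinity>^L\<close> has nuclear norm 1 for every \<open>L\<close>, being an average of rank one operators
  built from characters of a cyclic group; hence \<open>diag d: l_1 \<rightarrow> l_\<infinity>\<close> is nuclear as soon as
  \<open>d \<rightarrow> 0\<close>, by cutting the indices into blocks on which \<open>\<bar>d\<bar> \<le> 2^{-m}\<close>.
  It remains to apply this to \<open>e_n = 1 / (n ln n (ln ln n)^2)\<close>.
\<close>

section \<open>Sequence spaces normed by a supremum of seminorms\<close>

lemma sum_fun_apply: "(\<Sum>n\<in>A. f n) i = (\<Sum>n\<in>A. f n i)"
  for f :: "'b \<Rightarrow> 'a \<Rightarrow> 'c::comm_monoid_add"
  by (induction A rule: infinite_finite_induct) auto

definition diag :: "(nat \<Rightarrow> complex) \<Rightarrow> (nat \<Rightarrow> complex) \<Rightarrow> nat \<Rightarrow> complex" where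
  "diag d x = (\<lambda>i. d i * x i)"

text \<open>Both \<open>l_1\<close> and \<open>l_\<infinity>\<close> are normed by a supremum of seminorms that are continuous for
  coordinatewise convergence, so completeness and nuclearity are treated once for both.\<close>

locale coordinate_seminorms =
  fixes p :: "nat \<Rightarrow> (nat \<Rightarrow> complex) \<Rightarrow> real"
  assumes nonneg: "0 \<le> p N x"
    and scale: "p N (\<lambda>i. c * x i) = cmod c * p N x"
    and triangle: "p N (x + y) \<le> p N x + p N y"
    and continuous: "(\<And>i. (\<lambda>k. u k i) \<longlonglongrightarrow> x i) \<Longrightarrow> (\<lambda>k. p N (u k)) \<longlonglongrightarrow> p N x"
    and coordinate: "\<exists>N. \<forall>x. cmod (x i) \<le> p N x"
begin

definition carrier :: "(nat \<Rightarrow> complex) set" where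
  "carrier = {x. bdd_above (range (\<lambda>N. p N x))}"

text \<open>For an unbounded range the real \<open>SUP\<close> carries no information; the value is
  meaningful on \<open>carrier\<close> only.\<close>

definition sup_norm :: "(nat \<Rightarrow> complex) \<Rightarrow> real" where
  "sup_norm x = (SUP N. p N x)"

lemma le_sup_norm: "x \<in> carrier \<Longrightarrow> p N x \<le> sup_norm x"
  unfolding carrier_def sup_norm_def by (rule cSUP_upper) auto

lemma sup_norm_le: "(\<And>N. p N x \<le> B) \<Longrightarrow> sup_norm x \<le> B"
  unfolding sup_norm_def by (rule cSUP_least) auto

lemma carrierI: "(\<And>N. p N x \<le> B) \<Longrightarrow> x \<in> carrier"
  unfolding carrier_def by (auto intro!: bdd_aboveI)

lemma sup_norm_nonneg: "x \<in> carrier \<Longrightarrow> 0 \<le> sup_norm x"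
  using le_sup_norm[of x 0] nonneg[of 0 x] by linarith

lemma zero: "p N 0 = 0"
  using scale[of N 0 0] by (simp add: zero_fun_def)

lemma zero_mem: "0 \<in> carrier"
  by (rule carrierI[of _ 0]) (simp add: zero)

lemma add_mem:
  assumes "x \<in> carrier" "y \<in> carrier"
  shows "x + y \<in> carrier" and "sup_norm (x + y) \<le> sup_norm x + sup_norm y"
proof -
  have *: "p N (x + y) \<le> sup_norm x + sup_norm y" for N
    using triangle[of N x y] le_sup_norm[OF assms(1), of N] le_sup_norm[OF assms(2), of N]
    by linarith
  show "x + y \<in> carrier" using * by (rule carrierI)
  show "sup_norm (x + y) \<le> sup_norm x + sup_norm y" using * by (rule sup_norm_le)
qed

lemma scale_mem: "x \<in> carrier \<Longrightarrow> (\<lambda>i. c * x i) \<in> carrier"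
  by (rule carrierI[of _ "cmod c * sup_norm x"]) (auto simp: scale intro!: mult_left_mono le_sup_norm)

lemma sup_norm_scale:
  assumes "x \<in> carrier"
  shows "sup_norm (\<lambda>i. c * x i) = cmod c * sup_norm x"
proof (rule antisym)
  have le: "sup_norm (\<lambda>i. c * x i) \<le> cmod c * sup_norm x" if "x \<in> carrier" for c x
    by (rule sup_norm_le) (auto simp: scale intro!: mult_left_mono le_sup_norm that)
  show "sup_norm (\<lambda>i. c * x i) \<le> cmod c * sup_norm x" using le assms .
  show "cmod c * sup_norm x \<le> sup_norm (\<lambda>i. c * x i)"
  proof (cases "c = 0")
    case True
    then show ?thesis using sup_norm_nonneg[OF scale_mem[OF assms, of c]] by simp
  next
    case False
    then have "sup_norm x \<le> cmod (1 / c) * sup_norm (\<lambda>i. c * x i)"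
      using le[OF scale_mem[OF assms, of c], of "1 / c"] by simp
    then show ?thesis using False by (simp add: norm_divide field_simps)
  qed
qed

lemma subspace_carrier: "cseq.subspace carrier"
  unfolding cseq.subspace_def using zero_mem add_mem(1) scale_mem by auto

lemma diff_mem: "x \<in> carrier \<Longrightarrow> y \<in> carrier \<Longrightarrow> x - y \<in> carrier"
  using cseq.subspace_diff[OF subspace_carrier] .

lemma coordinate_le_sup_norm: "x \<in> carrier \<Longrightarrow> cmod (x i) \<le> sup_norm x"
  using coordinate[of i] le_sup_norm order_trans by metis

lemma sup_norm_eq_0_iff:
  assumes "x \<in> carrier"
  shows "sup_norm x = 0 \<longleftrightarrow> x = 0"
proof
  assume "sup_norm x = 0"
  then have "cmod (x i) \<le> 0" for i
    using coordinate_le_sup_norm[OF assms, of i] by simp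
  then show "x = 0" by (auto simp: fun_eq_iff)
next
  assume "x = 0"
  then show "sup_norm x = 0" by (simp add: sup_norm_def zero)
qed

text \<open>A Cauchy sequence converges in every coordinate because the norm dominates the
  coordinates. Letting \<open>n\<close> tend to infinity in \<open>p M (u m - u n)\<close>, with
  \<open>m\<close> and \<open>M\<close> fixed, gives a bound independent of \<open>M\<close>, hence
  a bound on the norm of \<open>u m - x\<close>.\<close>

lemma complete:
  assumes u: "\<And>n. u n \<in> carrier"
    and cauchy: "\<And>\<epsilon>. \<epsilon> > 0 \<Longrightarrow> \<exists>N. \<forall>m\<ge>N. \<forall>n\<ge>N. sup_norm (u m - u n) < \<epsilon>"
  shows "\<exists>x\<in>carrier. (\<lambda>n. sup_norm (u n - x)) \<longlonglongrightarrow> 0"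
proof -
  have "Cauchy (\<lambda>n. u n i)" for i
  proof (rule CauchyI)
    fix \<epsilon> :: real assume "\<epsilon> > 0"
    then obtain N where N: "\<And>m n. m \<ge> N \<Longrightarrow> n \<ge> N \<Longrightarrow> sup_norm (u m - u n) < \<epsilon>"
      using cauchy by blast
    have "norm (u m i - u n i) < \<epsilon>" if "m \<ge> N" "n \<ge> N" for m n
      using N[OF that] coordinate_le_sup_norm[OF diff_mem[OF u[of m] u[of n]], of i] by simp
    then show "\<exists>M. \<forall>m\<ge>M. \<forall>n\<ge>M. norm (u m i - u n i) < \<epsilon>" by blast
  qed
  then have "\<exists>l. (\<lambda>n. u n i) \<longlonglongrightarrow> l" for i
    using Cauchy_convergent_iff convergent_def by blast
  then obtain x where x: "\<And>i. (\<lambda>n. u n i) \<longlonglongrightarrow> x i" by metis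
  have lim: "p M (u m - x) \<le> \<epsilon>"
    if N: "\<And>m n. m \<ge> N \<Longrightarrow> n \<ge> N \<Longrightarrow> sup_norm (u m - u n) < \<epsilon>" and "m \<ge> N" for \<epsilon> N m M
  proof (rule LIMSEQ_le_const2)
    show "(\<lambda>n. p M (u m - u n)) \<longlonglongrightarrow> p M (u m - x)"
      by (rule continuous) (auto intro!: tendsto_intros x)
    have "p M (u m - u n) \<le> \<epsilon>" if "n \<ge> N" for n
      using that(1) \<open>m \<ge> N\<close> le_sup_norm[OF diff_mem[OF u[of m] u[of n]], of M] N by force
    then show "\<exists>K. \<forall>n\<ge>K. p M (u m - u n) \<le> \<epsilon>" by blast
  qed
  obtain N where "\<And>m n. m \<ge> N \<Longrightarrow> n \<ge> N \<Longrightarrow> sup_norm (u m - u n) < 1"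
    using cauchy[of 1] by auto
  then have "u N - x \<in> carrier"
    using lim[of N 1 N] by (auto intro: carrierI)
  then have "x \<in> carrier" using diff_mem[OF u, of "u N - x" N] by simp
  moreover have "(\<lambda>n. sup_norm (u n - x)) \<longlonglongrightarrow> 0"
  proof (rule LIMSEQ_I)
    fix \<epsilon> :: real assume "\<epsilon> > 0"
    then obtain N where N: "\<And>m n. m \<ge> N \<Longrightarrow> n \<ge> N \<Longrightarrow> sup_norm (u m - u n) < \<epsilon> / 2"
      using cauchy[of "\<epsilon> / 2"] by auto
    have "sup_norm (u n - x) \<le> \<epsilon> / 2" if "n \<ge> N" for n
      by (rule sup_norm_le) (rule lim[OF N that])
    then have "norm (sup_norm (u n - x) - 0) < \<epsilon>" if "n \<ge> N" for n
      using that \<open>\<epsilon> > 0\<close> sup_norm_nonneg[OF diff_mem[OF u[of n] \<open>x \<in> carrier\<close>]] by fastforce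
    then show "\<exists>N. \<forall>n\<ge>N. norm (sup_norm (u n - x) - 0) < \<epsilon>" by blast
  qed
  ultimately show ?thesis by blast
qed

lemma banach: "cseq.banach_space_on carrier sup_norm"
  unfolding cseq.banach_space_on_def
  using subspace_carrier sup_norm_nonneg sup_norm_eq_0_iff sup_norm_scale add_mem(2) complete
  by blast

section \<open>Nuclear operators into such a space\<close>

lemma sum_le: "p M (\<Sum>n\<in>A. f n) \<le> (\<Sum>n\<in>A. p M (f n))"
proof (induction A rule: infinite_finite_induct)
  case (insert x A)
  have "p M (sum f (insert x A)) = p M (f x + sum f A)" by (subst sum.insert[OF insert(1,2)]) (rule refl)
  also have "\<dots> \<le> (\<Sum>n\<in>insert x A. p M (f n))"
    using triangle[of M "f x" "sum f A"] insert by simp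
  finally show ?case .
qed (use zero in \<open>auto simp: zero_fun_def\<close>)

text \<open>The remainder is the coordinatewise limit of finite sums of terms with index at least
  \<open>N\<close>. The triangle inequality bounds their seminorms, and \<open>continuous\<close>
  carries the bound to the limit. With \<open>D\<close> valid for all \<open>M\<close>, this bounds
  the norm of the remainder.\<close>

lemma tail_bound:
  assumes a: "summable (\<lambda>n. cmod (a n))" and y: "\<And>n. p M (y n) \<le> D"
    and z: "\<And>i. (\<lambda>n. a n * y n i) sums z i"
  shows "p M (z - (\<Sum>n<N. (\<lambda>i. a n * y n i))) \<le> D * (\<Sum>n. cmod (a (n + N)))"
proof (rule LIMSEQ_le_const2)
  show "(\<lambda>K. p M (\<Sum>n<K. (\<lambda>i. a (n + N) * y (n + N) i)))
      \<longlonglongrightarrow> p M (z - (\<Sum>n<N. (\<lambda>i. a n * y n i)))"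
  proof (rule continuous)
    fix i
    have "(\<lambda>n. a (n + N) * y (n + N) i) sums (z i - (\<Sum>n<N. a n * y n i))"
      using z[of i] by (rule sums_split_initial_segment)
    then show "(\<lambda>K. (\<Sum>n<K. (\<lambda>i. a (n + N) * y (n + N) i)) i)
        \<longlonglongrightarrow> (z - (\<Sum>n<N. (\<lambda>i. a n * y n i))) i"
      by (simp add: sums_def sum_fun_apply)
  qed
  have D: "0 \<le> D" using y[of 0] nonneg[of M "y 0"] by linarith
  have "p M (\<Sum>n<K. (\<lambda>i. a (n + N) * y (n + N) i)) \<le> D * (\<Sum>n. cmod (a (n + N)))" for K
  proof -
    have "p M (\<Sum>n<K. (\<lambda>i. a (n + N) * y (n + N) i))
        \<le> (\<Sum>n<K. p M (\<lambda>i. a (n + N) * y (n + N) i))"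
      by (rule sum_le)
    also have "\<dots> \<le> (\<Sum>n<K. cmod (a (n + N)) * D)"
      by (intro sum_mono) (auto simp: scale intro!: mult_left_mono y)
    also have "\<dots> = D * (\<Sum>n<K. cmod (a (n + N)))"
      by (simp add: sum_distrib_left mult.commute)
    also have "\<dots> \<le> D * (\<Sum>n. cmod (a (n + N)))"
      using a D by (intro mult_left_mono sum_le_suminf) (auto simp: summable_iff_shift[of "\<lambda>n. cmod (a n)"])
    finally show ?thesis .
  qed
  then show "\<exists>K0. \<forall>K\<ge>K0. p M (\<Sum>n<K. (\<lambda>i. a (n + N) * y (n + N) i))
      \<le> D * (\<Sum>n. cmod (a (n + N)))"
    by blast
qed

text \<open>Reduces nuclearity to a coordinatewise check: once the series represents
  \<open>T x\<close> in each coordinate, summability of \<open>\<mu>\<close> and the uniform bounds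
  \<open>C\<close> and \<open>D\<close> give convergence in norm by \<open>tail_bound\<close>. Its
  case \<open>N = 0\<close> makes \<open>T\<close> bounded, and uniqueness of sums makes
  \<open>T\<close> linear.\<close>

lemma nuclear_operatorI:
  assumes X: "cseq.subspace X"
    and \<mu>: "summable (\<lambda>n. cmod (\<mu> n))"
    and lin: "\<And>n. cseq.linear_functional_on X (x' n)"
    and x': "\<And>n x. x \<in> X \<Longrightarrow> cmod (x' n x) \<le> C * nX x"
    and y: "\<And>n M. p M (y n) \<le> D"
    and T: "\<And>x i. x \<in> X \<Longrightarrow> (\<lambda>n. \<mu> n * x' n x * y n i) sums T x i"
  shows "cseq.nuclear_operator X nX carrier sup_norm T"
proof -
  have le: "cmod (\<mu> n * x' n x) \<le> cmod (\<mu> n) * (C * nX x)" if "x \<in> X" for n x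
    by (auto simp: norm_mult intro!: mult_left_mono x' that)
  have sm: "summable (\<lambda>n. cmod (\<mu> n * x' n x))" if "x \<in> X" for x
    by (rule summable_comparison_test'[where N = 0, OF summable_mult2[OF \<mu>, of "C * nX x"]])
      (use le[OF that] in simp)
  have D: "0 \<le> D" using y[of 0 0] nonneg[of 0 "y 0"] by linarith
  have tail: "p M (T x - (\<Sum>n<N. (\<lambda>i. \<mu> n * x' n x * y n i)))
      \<le> D * (\<Sum>n. cmod (\<mu> (n + N) * x' (n + N) x))" if "x \<in> X" for x N M
    by (rule tail_bound[OF sm[OF that] y T[OF that]])
  have Tle: "p M (T x) \<le> D * (\<Sum>n. cmod (\<mu> n)) * C * nX x" if "x \<in> X" for x M
  proof -
    have "p M (T x) \<le> D * (\<Sum>n. cmod (\<mu> n * x' n x))" using tail[OF that, of M 0] by simp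
    also have "\<dots> \<le> D * (\<Sum>n. cmod (\<mu> n) * (C * nX x))"
      using D le[OF that] sm[OF that] \<mu> by (intro mult_left_mono suminf_le summable_mult2) auto
    also have "\<dots> = D * (\<Sum>n. cmod (\<mu> n)) * C * nX x"
      using suminf_mult2[OF \<mu>, of "C * nX x"] by simp
    finally show ?thesis .
  qed
  have Tmem: "T x \<in> carrier" if "x \<in> X" for x
    using Tle[OF that] by (rule carrierI)
  have "cseq.bounded_operator X nX carrier sup_norm T"
    unfolding cseq.bounded_operator_def
  proof (intro conjI ballI allI)
    fix x assume x: "x \<in> X"
    show "T x \<in> carrier" using Tmem[OF x] .
    { fix w assume w: "w \<in> X"
      have xw: "x + w \<in> X" using X x w by (rule cseq.subspace_add)
      have "T (x + w) i = T x i + T w i" for i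
      proof (rule sums_unique2[OF T[OF xw]])
        show "(\<lambda>n. \<mu> n * x' n (x + w) * y n i) sums (T x i + T w i)"
          using sums_add[OF T[OF x] T[OF w], of i i] lin x w
          by (simp add: cseq.linear_functional_on_def algebra_simps)
      qed
      then show "T (x + w) = T x + T w" by auto }
    { fix c
      have cx: "(\<lambda>i. c * x i) \<in> X" using X x by (rule cseq.subspace_scale)
      have "T (\<lambda>i. c * x i) i = c * T x i" for i
      proof (rule sums_unique2[OF T[OF cx]])
        show "(\<lambda>n. \<mu> n * x' n (\<lambda>i. c * x i) * y n i) sums (c * T x i)"
          using sums_mult[OF T[OF x], of c i] lin x
          by (simp add: cseq.linear_functional_on_def algebra_simps)
      qed
      then show "T (\<lambda>i. c * x i) = (\<lambda>i. c * T x i)" by auto }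
  next
    show "\<exists>C. \<forall>x\<in>X. sup_norm (T x) \<le> C * nX x"
      using Tle by (intro exI[of _ "D * (\<Sum>n. cmod (\<mu> n)) * C"] ballI sup_norm_le)
  qed
  moreover have "(\<lambda>N. sup_norm (T x - (\<Sum>n<N. (\<lambda>i. \<mu> n * x' n x * y n i)))) \<longlonglongrightarrow> 0"
    if x: "x \<in> X" for x
  proof (rule tendsto_sandwich)
    have ym: "(\<lambda>i. c * y n i) \<in> carrier" for c n
      by (rule scale_mem) (rule carrierI[OF y])
    have "T x - (\<Sum>n<N. (\<lambda>i. \<mu> n * x' n x * y n i)) \<in> carrier" for N
      by (intro diff_mem Tmem x cseq.subspace_sum[OF subspace_carrier] ym)
    then show "\<forall>\<^sub>F N in sequentially. 0 \<le> sup_norm (T x - (\<Sum>n<N. (\<lambda>i. \<mu> n * x' n x * y n i)))"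
      by (auto intro!: always_eventually sup_norm_nonneg)
    show "\<forall>\<^sub>F N in sequentially. sup_norm (T x - (\<Sum>n<N. (\<lambda>i. \<mu> n * x' n x * y n i)))
        \<le> D * (\<Sum>n. cmod (\<mu> (n + N) * x' (n + N) x))"
      by (auto intro!: always_eventually sup_norm_le tail x)
    have "(\<lambda>N. \<Sum>n. cmod (\<mu> (n + N) * x' (n + N) x)) \<longlonglongrightarrow> 0"
    proof (rule LIMSEQ_I)
      fix r :: real assume "r > 0"
      then show "\<exists>N. \<forall>M\<ge>N. norm ((\<Sum>n. cmod (\<mu> (n + M) * x' (n + M) x)) - 0) < r"
        using suminf_exist_split[OF _ sm[OF x], of r] by simp
    qed
    then show "(\<lambda>N. D * (\<Sum>n. cmod (\<mu> (n + N) * x' (n + N) x))) \<longlonglongrightarrow> 0"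
      using tendsto_mult_left[of _ 0 _ D] by simp
  qed simp
  moreover have "y n \<in> carrier" for n using y by (rule carrierI)
  moreover have "sup_norm (y n) \<le> D" for n using y by (rule sup_norm_le)
  ultimately show ?thesis
    unfolding cseq.nuclear_operator_def using \<mu> lin x'
    by (intro conjI exI[of _ \<mu>] exI[of _ x'] exI[of _ y] exI[of _ C] exI[of _ D] allI ballI) assumption+
qed

end

section \<open>The spaces \<open>l_1\<close> and \<open>l_\<infinity>\<close>\<close>

text \<open>Partial sums stand in for the full sum: each involves finitely many coordinates, hence
  is continuous for coordinatewise convergence, and their supremum is the usual norm.\<close>

interpretation l1: coordinate_seminorms "\<lambda>N x. \<Sum>i<N. cmod (x i)"
proof
  fix N i :: nat and x y :: "nat \<Rightarrow> complex" and c :: complex and u :: "nat \<Rightarrow> nat \<Rightarrow> complex"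
  show "(\<Sum>i<N. cmod (c * x i)) = cmod c * (\<Sum>i<N. cmod (x i))"
    by (simp add: norm_mult sum_distrib_left)
  show "(\<Sum>i<N. cmod ((x + y) i)) \<le> (\<Sum>i<N. cmod (x i)) + (\<Sum>i<N. cmod (y i))"
    by (simp flip: sum.distrib add: sum_mono norm_triangle_ineq)
  show "\<exists>N. \<forall>x. cmod (x i) \<le> (\<Sum>i<N. cmod (x i))"
    by (intro exI[of _ "Suc i"] allI) (simp add: sum_nonneg)
  show "(\<lambda>k. \<Sum>i<N. cmod (u k i)) \<longlonglongrightarrow> (\<Sum>i<N. cmod (x i))" if "\<And>i. (\<lambda>k. u k i) \<longlonglongrightarrow> x i"
    by (intro tendsto_intros that)
qed (auto intro: sum_nonneg)

interpretation linf: coordinate_seminorms "\<lambda>N x. cmod (x N)"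
  by unfold_locales (auto simp: norm_mult norm_triangle_ineq intro: tendsto_intros)

section \<open>Nuclearity of diagonal operators\<close>

text \<open>Coordinate functionals have norm at most 1 on \<open>l_\<infinity>\<close> and unit
  vectors have norm 1 in \<open>l_1\<close>, so \<open>b\<close> itself can serve as the sequence of
  weights.\<close>

lemma nuclear_diag_linf_l1:
  assumes "summable (\<lambda>n. cmod (b n))"
  shows "cseq.nuclear_operator linf.carrier linf.sup_norm l1.carrier l1.sup_norm (diag b)"
proof (rule l1.nuclear_operatorI)
  let ?y = "\<lambda>n i :: nat. if i = n then 1 else 0 :: complex"
  show "(\<lambda>n. b n * x n * ?y n i) sums diag b x i" for x :: "nat \<Rightarrow> complex" and i
  proof -
    have "(\<lambda>n. b n * x n * ?y n i) = (\<lambda>n. if n = i then b n * x n else 0)" by auto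
    then show ?thesis using sums_single[of i "\<lambda>n. b n * x n"] by (simp add: diag_def)
  qed
  show "(\<Sum>i<M. cmod (?y n i)) \<le> 1" for n M
    by (simp add: if_distrib[of cmod] cong: if_cong)
  show "cmod (x n) \<le> 1 * linf.sup_norm x" if "x \<in> linf.carrier" for x n
    using linf.coordinate_le_sup_norm[OF that] by simp
qed (auto simp: assms linf.subspace_carrier cseq.linear_functional_on_def)

text \<open>Orthogonality of the characters of the cyclic group of order \<open>M\<close>: for
  distinct \<open>k\<close> and \<open>l\<close> the summands are powers of a root of unity other
  than 1, and these cancel over a full period. The interval starts at \<open>a\<close> because one
  block of indices will number both the coordinates and the characters.\<close>

lemma sum_roots_of_unity:
  fixes a :: nat
  assumes k: "k \<in> {a..<a + M}" and l: "l \<in> {a..<a + M}"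
  shows "(\<Sum>n\<in>{a..<a + M}. cis (2 * pi * n * (real k - real l) / M)) = (if k = l then of_nat M else 0)"
proof (cases "k = l")
  case False
  define z where "z = cis (2 * pi * (real k - real l) / M)"
  have M: "M > 0" using k by auto
  have pow: "cis (2 * pi * n * (real k - real l) / M) = z ^ n" for n :: nat
    unfolding z_def by (simp add: DeMoivre field_simps)
  have "z ^ M = cis (2 * pi * real_of_int (int k - int l))"
  proof -
    have "real M * (2 * pi * (real k - real l) / M) = 2 * pi * (real k - real l)"
      using M by simp
    then show ?thesis unfolding z_def DeMoivre by simp
  qed
  also have "\<dots> = 1" by (rule cis_multiple_2pi) auto
  finally have zM: "z ^ M = 1" .
  \<comment> \<open>If the root were 1, \<open>M\<close> would divide the nonzero number
    \<open>k - l\<close>, whose absolute value is less than \<open>M\<close>.\<close>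
  have "z \<noteq> 1"
  proof
    assume "z = 1"
    then have "cos (2 * pi * (real k - real l) / M) = 1" unfolding z_def by (simp add: complex_eq_iff)
    then obtain j :: int where "2 * pi * (real k - real l) / M = real_of_int j * 2 * pi"
      by (auto simp: cos_one_2pi_int)
    then have "2 * pi * (real k - real l) = 2 * pi * (real_of_int j * real M)"
      using M by (simp add: field_simps)
    then have "real k - real l = real_of_int j * real M" by (subst (asm) mult_left_cancel) auto
    then have j: "int k - int l = j * int M"
      by (metis of_int_diff of_int_eq_iff of_int_mult of_int_of_nat_eq)
    then have "int M dvd int k - int l" by simp
    moreover have "\<bar>int k - int l\<bar> < int M" using k l by auto
    ultimately have "int k - int l = 0" using zdvd_imp_le[of "int M" "\<bar>int k - int l\<bar>"] by auto
    then show False using False by simp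
  qed
  have "(\<Sum>n\<in>{a..<a + M}. z ^ n) = z ^ a * (\<Sum>n<M. z ^ n)"
    using sum.shift_bounds_nat_ivl[of "\<lambda>n. z ^ n" 0 a M]
    by (simp add: power_add sum_distrib_left add.commute atLeast0LessThan mult.commute)
  also have "(\<Sum>n<M. z ^ n) = 0"
    using geometric_sum[OF \<open>z \<noteq> 1\<close>, of M] zM by simp
  finally show ?thesis using False by (simp add: pow)
qed simp

lemma ex_block:
  fixes N :: "nat \<Rightarrow> nat"
  assumes "strict_mono N" "N 0 = 0"
  shows "\<exists>m. n \<in> {N m..<N (Suc m)}"
proof -
  have "n < N (Suc n)" using strict_mono_imp_increasing[OF assms(1), of "Suc n"] by simp
  then have "\<exists>m. n < N (Suc m)" ..
  define m where "m = (LEAST m. n < N (Suc m))"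
  have "n < N (Suc m)" unfolding m_def by (rule LeastI) fact
  moreover have "N m \<le> n"
  proof (cases m)
    case (Suc j)
    then show ?thesis using not_less_Least[of j "\<lambda>m. n < N (Suc m)"] unfolding m_def by simp
  qed (simp add: assms)
  ultimately show ?thesis by auto
qed

lemma ex_block_function:
  fixes N :: "nat \<Rightarrow> nat"
  assumes N: "strict_mono N" "N 0 = 0"
  shows "\<exists>g. \<forall>n m. g n = m \<longleftrightarrow> n \<in> {N m..<N (Suc m)}"
proof -
  obtain g where g: "n \<in> {N (g n)..<N (Suc (g n))}" for n
    using ex_block[OF N] by metis
  have less: False if "n \<in> {N m..<N (Suc m)}" "n \<in> {N m'..<N (Suc m')}" "m < m'" for n m m'
    using that strict_mono_less_eq[OF N(1), of "Suc m" m'] by simp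
  have "g n = m" if "n \<in> {N m..<N (Suc m)}" for n m
    using less that g[of n] by (metis nat_neq_iff)
  then show ?thesis using g by metis
qed

text \<open>Each threshold is chosen recursively beyond the previous one. Nothing makes
  \<open>d\<close> small before \<open>N 1\<close>, so the bounds start with
  \<open>Suc m\<close>.\<close>

lemma ex_fast_thresholds:
  fixes d :: "nat \<Rightarrow> 'a::real_normed_vector"
  assumes d: "d \<longlonglongrightarrow> 0"
  shows "\<exists>N. strict_mono N \<and> N 0 = 0 \<and> (\<forall>m. \<forall>n\<ge>N (Suc m). norm (d n) \<le> (1 / 2) ^ Suc m)"
proof -
  have "\<exists>N. N 0 = 0 \<and> (\<forall>m. N m < N (Suc m) \<and> (\<forall>n\<ge>N (Suc m). norm (d n) \<le> (1 / 2) ^ Suc m))"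
  proof -
    have "\<exists>k. j < k \<and> (\<forall>n\<ge>k. norm (d n) \<le> (1 / 2) ^ Suc m)" for j m :: nat
    proof -
      obtain k where k: "\<And>n. n \<ge> k \<Longrightarrow> norm (d n) < (1 / 2) ^ Suc m"
        using LIMSEQ_D[OF d, of "(1 / 2) ^ Suc m"] by auto
      then show ?thesis by (intro exI[of _ "max k (Suc j)"]) (auto intro: less_imp_le)
    qed
    then obtain f where "\<And>j m :: nat. j < f j m \<and> (\<forall>n\<ge>f j m. norm (d n) \<le> (1 / 2) ^ Suc m)" by metis
    then show ?thesis by (intro exI[of _ "rec_nat 0 (\<lambda>m j. f j m)"]) simp
  qed
  then show ?thesis by (auto simp: strict_mono_Suc_iff)
qed

text \<open>On a block of length \<open>L m\<close> the identity is the average, over the characters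
  \<open>\<omega> n\<close>, of the rank one maps that pair \<open>x\<close> with
  \<open>\<omega> n\<close> and multiply \<open>cnj (\<omega> n)\<close> by the result. The
  functionals have norm at most 1 on \<open>l_1\<close>, and the vectors are unimodular on the
  block. Of the diagonal factor \<open>d\<close>, the size \<open>(1 / 2) ^ m\<close> goes into
  \<open>\<mu>\<close> and the rest into \<open>y\<close>.\<close>

lemma nuclear_diag_l1_linf:
  assumes d: "d \<longlonglongrightarrow> 0"
  shows "cseq.nuclear_operator l1.carrier l1.sup_norm linf.carrier linf.sup_norm (diag d)"
proof -
  obtain N where N: "strict_mono N" "N 0 = 0"
    and dN: "\<And>m n. n \<ge> N (Suc m) \<Longrightarrow> cmod (d n) \<le> (1 / 2) ^ Suc m"
    using ex_fast_thresholds[OF d] by blast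
  obtain g where g: "\<And>n m. g n = m \<longleftrightarrow> n \<in> {N m..<N (Suc m)}"
    using ex_block_function[OF N] by blast
  define L where "L m = N (Suc m) - N m" for m
  \<comment> \<open>A block of \<open>L m\<close> coordinates uses \<open>L m\<close> characters, so
    the terms of the series are numbered by the same blocks.\<close>
  define \<mu> where "\<mu> n = complex_of_real ((1 / 2) ^ g n / L (g n))" for n
  define \<omega> where "\<omega> n k = cis (2 * pi * n * k / L (g n))" for n k :: nat
  define x' where "x' n x = (\<Sum>k\<in>{N (g n)..<N (Suc (g n))}. \<omega> n k * x k)" for n and x :: "nat \<Rightarrow> complex"
  define y where "y n l = (if g l = g n then 2 ^ g n * d l * cnj (\<omega> n l) else 0)" for n l
  have L: "L m > 0" and NL: "N (Suc m) = N m + L m" for m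
    using strict_monoD[OF N(1), of m "Suc m"] by (auto simp: L_def)
  have cmod_\<omega>: "cmod (\<omega> n k) = 1" for n k by (simp add: \<omega>_def)
  obtain D where D: "\<And>n. cmod (d n) \<le> D"
    using convergent_imp_Bseq[OF convergentI[OF d]] by (auto simp: Bseq_def)
  show ?thesis
  proof (rule linf.nuclear_operatorI[where \<mu> = \<mu> and x' = x' and y = y and C = 1 and D = "max D 1"])
    \<comment> \<open>Block \<open>m\<close> contributes \<open>L m\<close> weights
      \<open>(1 / 2) ^ m / L m\<close>, so the partial sums up to block boundaries are geometric;
      the others are bounded by monotonicity.\<close>
    have "(\<Sum>n<N M. cmod (\<mu> n)) = (\<Sum>m<M. (1 / 2) ^ m)" for M
    proof (induction M)
      case (Suc M)
      have "{..<N (Suc M)} = {..<N M} \<union> {N M..<N (Suc M)}" using NL[of M] by auto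
      then have "(\<Sum>n<N (Suc M). cmod (\<mu> n)) = (\<Sum>n<N M. cmod (\<mu> n)) + (\<Sum>n\<in>{N M..<N (Suc M)}. cmod (\<mu> n))"
        by (simp add: sum.union_disjoint ivl_disj_int)
      also have "(\<Sum>n\<in>{N M..<N (Suc M)}. cmod (\<mu> n)) = (\<Sum>n\<in>{N M..<N (Suc M)}. (1 / 2) ^ M / L M)"
      proof (rule sum.cong)
        fix n assume "n \<in> {N M..<N (Suc M)}"
        then have "g n = M" using g by blast
        then show "cmod (\<mu> n) = (1 / 2) ^ M / L M" unfolding \<mu>_def norm_of_real by simp
      qed simp
      also have "\<dots> = (1 / 2) ^ M" using L[of M] by (simp add: NL)
      finally show ?case using Suc by simp
    qed (simp add: N)
    then have bound: "(\<Sum>n<N M. cmod (\<mu> n)) \<le> 2" for M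
      using geometric_sum_less[of "1 / 2 :: real" "{..<M}"] by simp
    show "summable (\<lambda>n. cmod (\<mu> n))"
    proof (rule summableI_nonneg_bounded)
      fix M
      have "(\<Sum>n<M. cmod (\<mu> n)) \<le> (\<Sum>n<N M. cmod (\<mu> n))"
        using strict_mono_imp_increasing[OF N(1), of M] by (intro sum_mono2) auto
      then show "(\<Sum>n<M. cmod (\<mu> n)) \<le> 2" using bound[of M] by linarith
    qed simp
    show "cseq.linear_functional_on l1.carrier (x' n)" for n
      by (simp add: cseq.linear_functional_on_def x'_def algebra_simps sum.distrib sum_distrib_left)
    show "cmod (x' n x) \<le> 1 * l1.sup_norm x" if "x \<in> l1.carrier" for n x
    proof -
      have "cmod (x' n x) \<le> (\<Sum>k\<in>{N (g n)..<N (Suc (g n))}. cmod (\<omega> n k * x k))"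
        unfolding x'_def by (rule norm_sum)
      also have "\<dots> \<le> (\<Sum>k<N (Suc (g n)). cmod (x k))"
        by (simp add: norm_mult cmod_\<omega>) (intro sum_mono2, auto)
      also have "\<dots> \<le> l1.sup_norm x" using that by (rule l1.le_sup_norm)
      finally show ?thesis by simp
    qed
    show "cmod (y n M) \<le> max D 1" for n M
    proof (cases "g M = g n")
      case True
      \<comment> \<open>The factor \<open>2 ^ g M\<close> is 1 on block 0, where the general bound
        \<open>D\<close> serves; on later blocks the choice of the thresholds cancels it.\<close>
      have "2 ^ g M * cmod (d M) \<le> max D 1"
      proof (cases "g M")
        case 0
        then show ?thesis using D[of M] by simp
      next
        case (Suc m)
        then have "N (Suc m) \<le> M" using g[of M "Suc m"] by simp
        then have "cmod (d M) \<le> (1 / 2) ^ Suc m" by (rule dN)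
        then show ?thesis using Suc by (simp add: field_simps)
      qed
      then show ?thesis using True by (simp add: y_def norm_mult cmod_\<omega> norm_power)
    qed (simp add: y_def)
    show "(\<lambda>n. \<mu> n * x' n x * y n l) sums diag d x l" for x :: "nat \<Rightarrow> complex" and l
    proof -
      define B where "B = {N (g l)..<N (g l) + L (g l)}"
      have B: "n \<in> B \<longleftrightarrow> g n = g l" for n using g[of n "g l"] by (simp add: B_def NL)
      have l: "l \<in> B" by (simp add: B)
      \<comment> \<open>\<open>y n l\<close> vanishes unless \<open>n\<close> and \<open>l\<close>
        share a block, so only finitely many terms remain.\<close>
      have "(\<lambda>n. \<mu> n * x' n x * y n l) sums (\<Sum>n\<in>B. \<mu> n * x' n x * y n l)"
        by (rule sums_finite) (auto simp: B y_def B_def[symmetric], auto simp: B_def)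
      also have "(\<Sum>n\<in>B. \<mu> n * x' n x * y n l)
          = (\<Sum>n\<in>B. \<Sum>k\<in>B. d l / L (g l) * x k * cis (2 * pi * n * (real k - real l) / L (g l)))"
      proof (rule sum.cong[OF refl])
        fix n assume "n \<in> B"
        then have gn: "g n = g l" by (simp add: B)
        \<comment> \<open>The factor \<open>(1 / 2) ^ g n\<close> of \<open>\<mu> n\<close> cancels
          \<open>2 ^ g n\<close> in \<open>y n l\<close>.\<close>
        have "\<mu> n * x' n x * y n l = d l / L (g l) * (\<Sum>k\<in>B. \<omega> n k * x k) * cnj (\<omega> n l)"
          by (simp add: \<mu>_def x'_def y_def gn B_def NL power_divide)
        also have "\<dots> = (\<Sum>k\<in>B. d l / L (g l) * x k * (\<omega> n k * cnj (\<omega> n l)))"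
          by (simp add: sum_distrib_left sum_distrib_right mult_ac)
        also have "\<dots> = (\<Sum>k\<in>B. d l / L (g l) * x k * cis (2 * pi * n * (real k - real l) / L (g l)))"
          unfolding \<omega>_def gn cis_cnj cis_mult
          by (simp add: diff_divide_distrib right_diff_distrib)
        finally show "\<mu> n * x' n x * y n l
            = (\<Sum>k\<in>B. d l / L (g l) * x k * cis (2 * pi * n * (real k - real l) / L (g l)))" .
      qed
      \<comment> \<open>Summing over the characters first lets orthogonality single out
        \<open>k = l\<close>.\<close>
      also have "\<dots> = (\<Sum>k\<in>B. d l / L (g l) * x k * (\<Sum>n\<in>B. cis (2 * pi * n * (real k - real l) / L (g l))))"
        by (subst sum.swap) (simp add: sum_distrib_left)
      also have "\<dots> = (\<Sum>k\<in>B. d l / L (g l) * x k * (if k = l then of_nat (L (g l)) else 0))"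
        using l unfolding B_def by (intro sum.cong refl) (simp only: sum_roots_of_unity)
      also have "\<dots> = (\<Sum>k\<in>B. if k = l then d l * x l else 0)"
        using L[of "g l"] by (intro sum.cong) auto
      also have "\<dots> = diag d x l"
        using l by (subst sum.delta) (auto simp: B_def diag_def)
      finally show ?thesis .
    qed
  qed (rule l1.subspace_carrier)
qed

section \<open>Splitting a summable sequence\<close>

text \<open>With the tails \<open>r n\<close> of the series, the factors are
  \<open>sqrt (r n)\<close> and \<open>e n / sqrt (r n)\<close>. Since \<open>e n\<close> is the
  difference of consecutive tails and the tails decrease, the second factor is at most twice the
  difference of consecutive square roots, which telescopes. Positivity of \<open>e\<close> keeps the
  tails away from the value 0.\<close>

lemma summable_factorization:
  fixes e :: "nat \<Rightarrow> real"
  assumes pos: "\<And>n. e n > 0" and e: "summable e"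
  obtains d b where "d \<longlonglongrightarrow> 0" "summable b" "\<And>n. b n > 0" "\<And>n. e n = b n * d n"
proof -
  define r where "r n = (\<Sum>k. e (k + n))" for n
  have sm: "summable (\<lambda>k. e (k + n))" for n using e by (simp add: summable_iff_shift)
  have r_pos: "r n > 0" for n unfolding r_def by (rule suminf_pos[OF sm]) (rule pos)
  have r_Suc: "r n - r (Suc n) = e n" for n
    using suminf_split_head[OF sm[of n]] by (simp add: r_def)
  have r0: "r \<longlonglongrightarrow> 0"
  proof (rule LIMSEQ_I)
    fix \<epsilon> :: real assume "\<epsilon> > 0"
    then show "\<exists>N. \<forall>n\<ge>N. norm (r n - 0) < \<epsilon>"
      using suminf_exist_split[OF _ e, of \<epsilon>] by (simp add: r_def)
  qed
  have s0: "(\<lambda>n. sqrt (r n)) \<longlonglongrightarrow> 0" using tendsto_real_sqrt[OF r0] by simp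
  have "summable (\<lambda>n. e n / sqrt (r n))"
  proof (rule summable_comparison_test')
    show "summable (\<lambda>n. 2 * (sqrt (r n) - sqrt (r (Suc n))))"
      using telescope_summable'[OF s0] by (rule summable_mult)
    fix n
    have "e n = (sqrt (r n) - sqrt (r (Suc n))) * (sqrt (r n) + sqrt (r (Suc n)))"
      using r_pos[of n] r_pos[of "Suc n"] r_Suc[of n] by (simp add: algebra_simps)
    also have "\<dots> \<le> (sqrt (r n) - sqrt (r (Suc n))) * (2 * sqrt (r n))"
      using r_Suc[of n] pos[of n] by (intro mult_left_mono) auto
    finally show "norm (e n / sqrt (r n)) \<le> 2 * (sqrt (r n) - sqrt (r (Suc n)))"
      using r_pos[of n] pos[of n] by (simp add: field_simps)
  qed
  moreover have "e n / sqrt (r n) > 0" "e n = e n / sqrt (r n) * sqrt (r n)" for n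
    using r_pos[of n] pos[of n] by auto
  ultimately show ?thesis using s0 that by blast
qed

section \<open>Eigenvalues of diagonal operators\<close>

text \<open>Powers of the operator minus \<open>z\<close> are diagonal with entries
  \<open>(e i - z) ^ k\<close>, whose zeros are the same for all positive \<open>k\<close>.
  Generalized eigenvectors are therefore eigenvectors, and \<open>k = 1\<close> is the
  witness.\<close>

lemma generalized_eigenspace_diag:
  "cseq.generalized_eigenspace X (diag e) z = {x \<in> X. \<forall>i. e i \<noteq> z \<longrightarrow> x i = 0}"
proof -
  have pow: "((\<lambda>v. diag e v - (\<lambda>i. z * v i)) ^^ k) x = (\<lambda>i. (e i - z) ^ k * x i)" for k x
    by (induction k) (auto simp: diag_def fun_eq_iff algebra_simps)
  have "(\<exists>k. (\<lambda>i. (e i - z) ^ k * x i) = 0) \<longleftrightarrow> (\<forall>i. e i \<noteq> z \<longrightarrow> x i = 0)" for x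
    by (fastforce simp: fun_eq_iff intro: exI[of _ 1])
  then show ?thesis unfolding cseq.generalized_eigenspace_def pow by simp
qed

text \<open>Injectivity of \<open>e\<close> makes every eigenvalue simple: for
  \<open>z = e n\<close> the generalized eigenspace is the line through the \<open>n\<close>-th unit
  vector, for any other \<open>z\<close> it is zero. As \<open>e\<close> has no zero entry, the
  padding clause is vacuous.\<close>

lemma eigenvalue_sequence_diag:
  assumes X: "cseq.subspace X" and unit: "\<And>n. (\<lambda>i. if i = n then 1 else 0) \<in> X"
    and e: "inj e" "\<And>n. e n \<noteq> 0"
  shows "cseq.eigenvalue_sequence X (diag e) e"
  unfolding cseq.eigenvalue_sequence_def
proof (intro conjI allI impI)
  fix z
  let ?E = "cseq.generalized_eigenspace X (diag e) z"
  have "(\<exists>B. finite B \<and> ?E \<subseteq> cseq.span B) \<and> finite {n. e n = z} \<and> card {n. e n = z} = cseq.dim ?E"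
  proof (cases "\<exists>n. e n = z")
    case True
    then obtain n where n: "e n = z" ..
    have eq: "e i = z \<longleftrightarrow> i = n" for i using n e(1) by (auto dest: injD)
    define u :: "nat \<Rightarrow> complex" where "u = (\<lambda>i. if i = n then 1 else 0)"
    have E: "?E = range (\<lambda>c i. c * u i)"
    proof
      show "?E \<subseteq> range (\<lambda>c i. c * u i)"
      proof
        fix x assume "x \<in> ?E"
        then have "x = (\<lambda>i. x n * u i)" by (auto simp: generalized_eigenspace_diag eq u_def)
        then show "x \<in> range (\<lambda>c i. c * u i)" by blast
      qed
      show "range (\<lambda>c i. c * u i) \<subseteq> ?E"
      proof
        fix x assume "x \<in> range (\<lambda>c i. c * u i)"
        then obtain c where x: "x = (\<lambda>i. c * u i)" by blast
        have "x \<in> X" unfolding x using X by (rule cseq.subspace_scale) (simp add: u_def unit)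
        then show "x \<in> ?E" by (simp add: generalized_eigenspace_diag eq x u_def)
      qed
    qed
    have span: "cseq.span {u} = ?E" unfolding E by (rule cseq.span_singleton)
    have "u \<noteq> 0" by (auto simp: u_def fun_eq_iff)
    then have "cseq.independent {u}" by simp
    then have "cseq.dim ?E = 1" using cseq.dim_span_eq_card_independent[of "{u}"] span by simp
    then show ?thesis using span by (simp add: eq) (metis finite.emptyI finite_insert subset_refl)
  next
    case False
    then have "?E = {0}"
      using cseq.subspace_0[OF X] by (auto simp: generalized_eigenspace_diag fun_eq_iff)
    then have "?E = cseq.span {}" by simp
    then have "cseq.dim ?E = 0" by (metis cseq.dim_span_eq_card_independent cseq.independent_empty card.empty)
    with False \<open>?E = cseq.span {}\<close> show ?thesis by (metis (mono_tags) Collect_empty_eq card.empty finite.emptyI order_refl)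
  qed
  then show "\<exists>B. finite B \<and> ?E \<subseteq> cseq.span B" "finite {n. e n = z}" "card {n. e n = z} = cseq.dim ?E"
    by blast+
next
  fix m n assume "m \<le> n \<and> e m = 0"
  then show "e n = 0" using e by simp
qed

section \<open>Rearrangement and a divergence criterion\<close>

text \<open>A level below \<open>cmod (x n)\<close> is exceeded by the \<open>n + 1\<close> entries
  with index at most \<open>n\<close>, so it is not admissible in the infimum.\<close>

lemma decreasing_rearrangement_ge:
  assumes "decseq (\<lambda>n. cmod (x n))"
  shows "cmod (x n) \<le> decreasing_rearrangement x n"
  unfolding decreasing_rearrangement_def
proof (rule cInf_greatest)
  \<comment> \<open>The level \<open>cmod (x n)\<close> is admissible, so the infimum is taken over
    a nonempty set.\<close>
  have *: "{k. cmod (x n) < cmod (x k)} \<subseteq> {..<n}"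
  proof
    fix k assume "k \<in> {k. cmod (x n) < cmod (x k)}"
    then show "k \<in> {..<n}" using decseqD[OF assms, of n k] by (cases "n \<le> k") auto
  qed
  then have "finite {k. cmod (x n) < cmod (x k)}" "card {k. cmod (x n) < cmod (x k)} \<le> n"
    using finite_subset[OF *] card_mono[OF _ *] by simp_all
  then have "cmod (x n) \<in> {t. 0 \<le> t \<and> finite {k. t < cmod (x k)} \<and> card {k. t < cmod (x k)} \<le> n}"
    by simp
  then show "{t. 0 \<le> t \<and> finite {k. t < cmod (x k)} \<and> card {k. t < cmod (x k)} \<le> n} \<noteq> {}"
    by blast
next
  fix t assume t: "t \<in> {t. 0 \<le> t \<and> finite {k. t < cmod (x k)} \<and> card {k. t < cmod (x k)} \<le> n}"
  show "cmod (x n) \<le> t"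
  proof (rule ccontr)
    assume "\<not> cmod (x n) \<le> t"
    then have "t < cmod (x k)" if "k \<le> n" for k
      using decseqD[OF assms that] by simp
    then have "{..n} \<subseteq> {k. t < cmod (x k)}" by auto
    then have "Suc n \<le> card {k. t < cmod (x k)}" using t card_mono[of "{k. t < cmod (x k)}" "{..n}"] by simp
    then show False using t by simp
  qed
qed

text \<open>A discrete integral test with \<open>F\<close> in the role of an antiderivative:
  summability of \<open>f\<close> would pass to the increments of \<open>F\<close> and force
  \<open>F\<close> to converge.\<close>

lemma not_summable_if_telescope_bigo:
  fixes F f :: "nat \<Rightarrow> real"
  assumes F: "filterlim F at_top sequentially"
    and bigo: "(\<lambda>n. F (Suc n) - F n) \<in> O(f)"
    and f: "\<And>n. f n \<ge> 0"
  shows "\<not> summable f"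
proof
  assume "summable f"
  then have "summable (\<lambda>n. F (Suc n) - F n)"
    using f by (intro summable_comparison_test_bigo[OF _ bigo]) simp
  then obtain l where "(\<lambda>N. \<Sum>n<N. F (Suc n) - F n) \<longlonglongrightarrow> l"
    unfolding summable_def sums_def by blast
  then have "(\<lambda>N. F N - F 0) \<longlonglongrightarrow> l" unfolding sum_lessThan_telescope .
  then have "(\<lambda>N. F N - F 0 + F 0) \<longlonglongrightarrow> l + F 0" by (intro tendsto_add tendsto_const)
  then have "F \<longlonglongrightarrow> l + F 0" by simp
  moreover have "filterlim F at_infinity sequentially" using F by (rule filterlim_at_top_imp_at_infinity)
  ultimately show False by (intro not_tendsto_and_filterlim_at_infinity[OF sequentially_bot])
qed

section \<open>A sequence on the boundary of \<open>l_1\<close>\<close>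

text \<open>With a power \<open>a > 1\<close> of the logarithm the Lorentz series would converge for
  \<open>s > 1 / a\<close>, so the logarithm has exponent 1 and the squared iterated logarithm
  restores summability. The shift by 16 exceeds \<open>exp 1\<close>, which keeps the iterated
  logarithm positive from index 0 on.\<close>

definition slow_seq :: "nat \<Rightarrow> real" where
  "slow_seq n = 1 / ((real n + 16) * ln (real n + 16) * ln (ln (real n + 16)) ^ 2)"

lemma ln_16: "1 < ln (real n + 16)"
proof -
  have "exp 1 < real n + 16" using exp_le by (simp add: order_le_less_trans)
  then have "ln (exp 1) < ln (real n + 16)" by (subst ln_less_cancel_iff) auto
  then show ?thesis by simp
qed

lemma slow_seq_pos: "slow_seq n > 0"
  using ln_16[of n] by (simp add: slow_seq_def)

text \<open>All factors of the denominator are positive and strictly increasing. This serves twice: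
  for the simplicity of the eigenvalues and for comparing the sequence with its
  rearrangement.\<close>

lemma slow_seq_strict_antimono:
  assumes "m < n"
  shows "slow_seq n < slow_seq m"
proof -
  have L: "ln (real m + 16) < ln (real n + 16)" using assms by simp
  have LL: "0 < ln (ln (real m + 16))" "ln (ln (real m + 16)) < ln (ln (real n + 16))"
    using L ln_16[of m] ln_16[of n] by simp_all
  have "(real m + 16) * ln (real m + 16) < (real n + 16) * ln (real n + 16)"
    using L ln_16[of m] assms by (intro mult_strict_mono) simp_all
  moreover have "ln (ln (real m + 16)) ^ 2 < ln (ln (real n + 16)) ^ 2"
    using LL by (intro power_strict_mono) simp_all
  ultimately have "(real m + 16) * ln (real m + 16) * ln (ln (real m + 16)) ^ 2
      < (real n + 16) * ln (real n + 16) * ln (ln (real n + 16)) ^ 2"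
    using ln_16[of m] ln_16[of n] assms by (intro mult_strict_mono) simp_all
  moreover have "0 < (real m + 16) * ln (real m + 16) * ln (ln (real m + 16)) ^ 2"
    using ln_16[of m] LL by simp
  ultimately show ?thesis unfolding slow_seq_def by (simp add: frac_less2)
qed

text \<open>Up to sign, \<open>slow_seq\<close> is the derivative of \<open>1 / ln (ln x)\<close> at
  \<open>n + 16\<close>, hence of the order of the increments of this function, which
  telescope.\<close>

lemma summable_slow_seq: "summable slow_seq"
proof (rule summable_comparison_test_bigo)
  let ?F = "\<lambda>n :: nat. 1 / ln (ln (real n + 16))"
  have "?F (Suc n) \<le> ?F n" for n
    using ln_16[of n] ln_16[of "Suc n"] by (auto intro!: divide_left_mono)
  moreover have "?F \<longlonglongrightarrow> 0" by real_asymp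
  ultimately show "summable (\<lambda>n. norm (?F n - ?F (Suc n)))"
    using telescope_summable'[of ?F 0] by simp
  show "slow_seq \<in> O(\<lambda>n. ?F n - ?F (Suc n))" unfolding slow_seq_def by real_asymp
qed

text \<open>With \<open>m = n + 16\<close> the terms behave like
  \<open>1 / (m * ln m powr s * ln (ln m) powr (2 * s))\<close>. This dominates
  \<open>1 / (m * ln m)\<close>, the order of the increments of the unbounded function
  \<open>ln (ln m)\<close>.\<close>

lemma not_summable_slow_seq_powr:
  assumes "0 < s" "s < 1"
  shows "\<not> summable (\<lambda>n. real (n + 1) powr (s - 1) * slow_seq n powr s)"
proof (rule not_summable_if_telescope_bigo)
  let ?f = "\<lambda>n. real (n + 1) powr (s - 1) * slow_seq n powr s"
  show "filterlim (\<lambda>n. ln (ln (real n + 16))) at_top sequentially" by real_asymp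
  have "(\<lambda>n. ln (ln (real (Suc n) + 16)) - ln (ln (real n + 16)))
      \<in> O(\<lambda>n. 1 / ((real n + 16) * ln (real n + 16)))"
    by real_asymp
  also have "(\<lambda>n. 1 / ((real n + 16) * ln (real n + 16))) \<in> O(?f)"
  proof (rule landau_o.big_mono)
    \<comment> \<open>As \<open>1 - s\<close> is positive, this power of \<open>ln\<close>
      eventually beats any power of the iterated logarithm.\<close>
    have "\<forall>\<^sub>F n in sequentially. ln (ln (real n + 16)) powr (2 * s) \<le> ln (real n + 16) powr (1 - s)"
      using assms by real_asymp
    then show "\<forall>\<^sub>F n in sequentially. norm (1 / ((real n + 16) * ln (real n + 16))) \<le> norm (?f n)"
    proof eventually_elim
      case (elim n)
      define m where "m = real n + 16"
      have m: "m > 0" "ln m > 1" "ln (ln m) > 0" using ln_16[of n] by (auto simp: m_def)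
      have "ln m powr s * ln m powr (1 - s) = ln m" using m by (simp flip: powr_add)
      then have "1 / (m * ln m) = m powr (s - 1) * (1 / (m powr s * (ln m powr s * ln m powr (1 - s))))"
        using m by (simp only: powr_diff) simp
      also have "\<dots> \<le> real (n + 1) powr (s - 1) * (1 / (m powr s * (ln m powr s * ln (ln m) powr (2 * s))))"
      proof (rule mult_mono)
        show "m powr (s - 1) \<le> real (n + 1) powr (s - 1)"
          using assms by (intro powr_mono2') (auto simp: m_def)
        have "m powr s * (ln m powr s * ln (ln m) powr (2 * s)) \<le> m powr s * (ln m powr s * ln m powr (1 - s))"
          using elim by (intro mult_left_mono) (auto simp: m_def)
        then show "1 / (m powr s * (ln m powr s * ln m powr (1 - s)))
            \<le> 1 / (m powr s * (ln m powr s * ln (ln m) powr (2 * s)))"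
          using m by (intro divide_left_mono mult_pos_pos) auto
      qed simp_all
      also have "ln (ln m) powr (2 * s) = (ln (ln m) ^ 2) powr s"
      proof -
        have "ln (ln m) ^ 2 = ln (ln m) powr 2" using m by simp
        then show ?thesis by (simp only: powr_powr)
      qed
      also have "real (n + 1) powr (s - 1) * (1 / (m powr s * (ln m powr s * (ln (ln m) ^ 2) powr s))) = ?f n"
        using m unfolding slow_seq_def m_def[symmetric]
        by (simp add: powr_divide powr_mult mult.assoc)
      finally show ?case using m by (simp add: m_def)
    qed
  qed
  finally show "(\<lambda>n. ln (ln (real (Suc n) + 16)) - ln (ln (real n + 16))) \<in> O(?f)" .
qed simp

theorem corollary3p13:
  shows "\<exists>(X :: (nat \<Rightarrow> complex) set) nX (Y :: (nat \<Rightarrow> complex) set) nY t1 t2 e.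
     cseq.banach_space_on X nX \<and>
     cseq.banach_space_on Y nY \<and>
     cseq.nuclear_operator X nX Y nY t1 \<and>
     cseq.nuclear_operator Y nY X nX t2 \<and>
     cseq.eigenvalue_sequence X (t2 \<circ> t1) e \<and>
     e \<in> l1_space - (\<Union>s\<in>{0<..<1}. lorentz_space 1 s)"
proof -
  obtain d b where d: "d \<longlonglongrightarrow> 0" and b: "summable b" "\<And>n. b n > 0" and db: "\<And>n. slow_seq n = b n * d n"
    using summable_factorization[OF slow_seq_pos summable_slow_seq] by metis
  define e where "e n = complex_of_real (slow_seq n)" for n
  have cmod_e: "cmod (e n) = slow_seq n" for n using slow_seq_pos[of n] by (simp add: e_def)
  \<comment> \<open>The real factors are coerced to complex numbers, which is why \<open>d\<close>
    and \<open>b\<close> appear eta-expanded below.\<close>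
  have "(\<lambda>n. complex_of_real (d n)) \<longlonglongrightarrow> 0" using tendsto_of_real[OF d, where 'a = complex] by simp
  then have t1: "cseq.nuclear_operator l1.carrier l1.sup_norm linf.carrier linf.sup_norm (diag (\<lambda>n. d n))"
    by (rule nuclear_diag_l1_linf)
  have "summable (\<lambda>n. cmod (b n))" using b by (simp add: less_imp_le)
  then have t2: "cseq.nuclear_operator linf.carrier linf.sup_norm l1.carrier l1.sup_norm (diag (\<lambda>n. b n))"
    by (rule nuclear_diag_linf_l1)
  have prod: "diag (\<lambda>n. b n) \<circ> diag (\<lambda>n. d n) = diag e"
    by (auto simp: fun_eq_iff diag_def e_def db)
  have "cseq.eigenvalue_sequence l1.carrier (diag e) e"
  proof (rule eigenvalue_sequence_diag[OF l1.subspace_carrier])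
    show "(\<lambda>i. if i = n then 1 else 0) \<in> l1.carrier" for n
      by (rule l1.carrierI[of _ 1]) (simp add: if_distrib[of cmod] cong: if_cong)
    show "inj e"
      by (rule linorder_injI) (use slow_seq_strict_antimono in \<open>force simp: e_def\<close>)
    show "e n \<noteq> 0" for n using slow_seq_pos[of n] by (simp add: e_def)
  qed
  moreover have "e \<in> l1_space" using summable_slow_seq by (simp add: l1_space_def cmod_e)
  moreover have "e \<notin> lorentz_space 1 s" if s: "s \<in> {0<..<1}" for s
  proof
    have dec: "decseq (\<lambda>n. cmod (e n))"
      unfolding cmod_e decseq_def using slow_seq_strict_antimono by (metis le_neq_implies_less less_imp_le order_refl)
    \<comment> \<open>The moduli of \<open>e\<close> already decrease, so convergence of the Lorentz
      series passes from the rearrangement to \<open>slow_seq\<close> itself.\<close>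
    have le: "slow_seq n \<le> decreasing_rearrangement e n" for n
      using decreasing_rearrangement_ge[OF dec, of n] by (simp add: cmod_e)
    assume "e \<in> lorentz_space 1 s"
    \<comment> \<open>For \<open>p = 1\<close> and \<open>q = s\<close> the exponent
      \<open>q / p - 1\<close> is \<open>s - 1\<close>.\<close>
    then have "summable (\<lambda>n. real (n + 1) powr (s - 1) * decreasing_rearrangement e n powr s)"
      by (simp add: lorentz_space_def)
    then have "summable (\<lambda>n. real (n + 1) powr (s - 1) * slow_seq n powr s)"
    proof (rule summable_comparison_test'[where N = 0])
      fix n
      have "slow_seq n powr s \<le> decreasing_rearrangement e n powr s"
        using s le[of n] slow_seq_pos[of n] by (intro powr_mono2) auto
      then show "norm (real (n + 1) powr (s - 1) * slow_seq n powr s)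
          \<le> real (n + 1) powr (s - 1) * decreasing_rearrangement e n powr s"
        by (simp add: mult_left_mono)
    qed
    then show False using not_summable_slow_seq_powr s by simp
  qed
  ultimately have "e \<in> l1_space - (\<Union>s\<in>{0<..<1}. lorentz_space 1 s)" by blast
  moreover have "cseq.eigenvalue_sequence l1.carrier (diag (\<lambda>n. b n) \<circ> diag (\<lambda>n. d n)) e"
    unfolding prod by fact
  ultimately show ?thesis using l1.banach linf.banach t1 t2
    by (intro exI[of _ l1.carrier] exI[of _ l1.sup_norm] exI[of _ linf.carrier] exI[of _ linf.sup_norm]
        exI[of _ "diag (\<lambda>n. d n)"] exI[of _ "diag (\<lambda>n. b n)"] exI[of _ e] conjI)
qed

end
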